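(* For every set of formulas $\Phi\cup\{\psi\}\subseteq\mathcal L$: if $\Phi\models_{\mathsf{InqI}}\psi$, then $\Phi\vdash_{\mathsf{InqI}}\psi$.
   Context: Fix a set $\mathcal P$ of atomic sentences. The language $\mathcal L$ is given by $\varphi::=p\mid\bot\mid\varphi\land\varphi\mid\varphi\lor\varphi\mid\varphi\to\varphi\mid\varphi\sqcup\varphi$ with $p\in\mathcal P$, where $\lor$ is standard disjunction and $\sqcup$ denotes inquisitive disjunction. Standard formulas are those with no occurrence of $\sqcup$. An intuitionistic Kripke model is $M=\langle W,R,V\rangle$ with $W$ a set (of worlds), $R$ a partial order on $W$, and $V:W\times\mathcal P\to\{0,1\}$ such that $wRw'$ and $V(w,p)=1$ imply $V(w',p)=1$. A team is a set $t\subseteq W$; $R[w]=\{w'\mid wRw'\}$ and $R[t]=\bigcup_{w\in t}R[w]$. Support $M,t\models\varphi$ is defined by: - $M,t\models p$ iff $V(w,p)=1$ for all $w\in t$; - $M,t\models\bot$ iff $t=\emptyset$; - $M,t\models\varphi\land\psi$ iff $M,t\models\varphi$ and $M,t\models\psi$; - $M,t\models\varphi\lor\psi$ iff there are $t',t''$ with $t=t'\cup t''$, $M,t'\models\varphi$ and $M,t''\models\psi$; - $M,t\models\varphi\to\psi$ iff for all $t'\subseteq R[t]$, $M,t'\models\varphi$ implies $M,t'\models\psi$; - $M,t\models\varphi\sqcup\psi$ iff $M,t\models\varphi$ or $M,t\models\psi$. $\Phi\models_{\mathsf{InqI}}\psi$ means: for every intuitionistic Kripke model $M$ and team $t$ in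 $M$, if $M,t\models\varphi$ for all $\varphi\in\Phi$ then $M,t\models\psi$. $\Phi\vdash_{\mathsf{InqI}}\psi$ means that there is a natural deduction proof of $\psi$ from (finitely many) assumptions in $\Phi$ using the following rules, where $\varphi,\psi,\chi,\varphi',\psi'$ range over all formulas of $\mathcal L$ and $\alpha$ ranges only over standard formulas: - $(\land\mathsf i)$ from $\varphi$ and $\psi$ infer $\varphi\land\psi$; $(\land\mathsf e)$ from $\varphi\land\psi$ infer $\varphi$, and infer $\psi$; - $(\to\mathsf i)$ from a derivation of $\psi$ from assumption $\varphi$ infer $\varphi\to\psi$, discharging $\varphi$; $(\to\mathsf e)$ from $\varphi$ and $\varphi\to\psi$ infer $\psi$; - $(\sqcup\mathsf i)$ from $\varphi$ infer $\varphi\sqcup\psi$, and from $\psi$ infer $\varphi\sqcup\psi$; $(\sqcup\mathsf e)$ from $\varphi\sqcup\psi$, a derivation of $\chi$ from $\varphi$, and a derivation of $\chi$ from $\psi$, infer $\chi$, discharging $\varphi$ and $\psi$; - $(\lor\mathsf i)$ from $\varphi$ infer $\varphi\lor\psi$, and from $\psi$ infer $\varphi\lor\psi$; $(\lor\mathsf e)$ from $\varphi\lor\psi$, a derivation of $\alpha$ from $\varphi$, and a derivation of $\alpha$ from $\psi$, infer $\alpha$ ($\alpha$ standard), discharging $\varphi$ and $\psi$; - $(\lor\mathsf a)$ from $\varphi\lor(\psi\lor\chi)$ infer $(\varphi\lor\psi)\lor\chi$; $(\lor\mathsf c)$ from $\varphi\lor\psi$ infer $\psi\lor\varphi$; - $(\lor\mathsf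 r)$ from $\varphi\lor\psi$, a derivation of $\varphi'$ from $\varphi$, and a derivation of $\psi'$ from $\psi$, infer $\varphi'\lor\psi'$, discharging $\varphi$ and $\psi$; - $(\lor\mathsf d)$ from $\varphi\lor(\psi\sqcup\chi)$ infer $(\varphi\lor\psi)\sqcup(\varphi\lor\chi)$; - $(\bot\mathsf e)$ from $\bot$ infer $\varphi$; - $(\mathsf S)$ from $\alpha\to(\varphi\sqcup\psi)$ infer $(\alpha\to\varphi)\sqcup(\alpha\to\psi)$ ($\alpha$ standard). *)

theory Defs
  imports Main
begin

datatype 'p form =
    Atom 'p
  | Bot  ("\<bottom>\<^sub>I")
  | Conj "'p form" "'p form"  (infixr "\<^bold>\<and>" 65)
  | Disj "'p form" "'p form"  (infixr "\<^bold>\<or>" 63)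
  | Imp  "'p form" "'p form"  (infixr "\<^bold>\<rightarrow>" 61)
  | IDisj "'p form" "'p form"  (infixr "\<^bold>\<squnion>" 62)

primrec standard :: "'p form \<Rightarrow> bool" where
  "standard (Atom p) \<longleftrightarrow> True"
| "standard \<bottom>\<^sub>I \<longleftrightarrow> True"
| "standard (\<phi> \<^bold>\<and> \<psi>) \<longleftrightarrow> standard \<phi> \<and> standard \<psi>"
| "standard (\<phi> \<^bold>\<or> \<psi>) \<longleftrightarrow> standard \<phi> \<and> standard \<psi>"
| "standard (\<phi> \<^bold>\<rightarrow> \<psi>) \<longleftrightarrow> standard \<phi> \<and> standard \<psi>"
| "standard (\<phi> \<^bold>\<squnion> \<psi>) \<longleftrightarrow> False"


subsection \<open>Intuitionistic Kripke models and support\<close>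

record ('w, 'p) kripke =
  worlds :: "'w set"
  acc :: "('w \<times> 'w) set"
  val :: "'w \<Rightarrow> 'p \<Rightarrow> bool"

text \<open>\<^const>\<open>partial_order_on\<close> includes \<open>acc M \<subseteq> worlds M \<times> worlds M\<close>. The values of
  \<open>val M\<close> outside \<open>worlds M\<close> are junk and never inspected, since teams are subsets of
  \<open>worlds M\<close>.\<close>

definition kripke_model :: "('w, 'p) kripke \<Rightarrow> bool" where
  "kripke_model M \<longleftrightarrow>
     partial_order_on (worlds M) (acc M) \<and>
     (\<forall>w w' p. (w, w') \<in> acc M \<longrightarrow> val M w p \<longrightarrow> val M w' p)"

definition team :: "('w, 'p) kripke \<Rightarrow> 'w set \<Rightarrow> bool" where
  "team M t \<longleftrightarrow> t \<subseteq> worlds M"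

text \<open>The relational image \<open>acc M `` t\<close> is \<open>R[t]\<close>.\<close>

primrec supports :: "('w, 'p) kripke \<Rightarrow> 'w set \<Rightarrow> 'p form \<Rightarrow> bool" where
  "supports M t (Atom p) \<longleftrightarrow> (\<forall>w\<in>t. val M w p)"
| "supports M t \<bottom>\<^sub>I \<longleftrightarrow> t = {}"
| "supports M t (\<phi> \<^bold>\<and> \<psi>) \<longleftrightarrow> supports M t \<phi> \<and> supports M t \<psi>"
| "supports M t (\<phi> \<^bold>\<or> \<psi>) \<longleftrightarrow>
     (\<exists>t' t''. t = t' \<union> t'' \<and> supports M t' \<phi> \<and> supports M t'' \<psi>)"
| "supports M t (\<phi> \<^bold>\<rightarrow> \<psi>) \<longleftrightarrow>
     (\<forall>t'. t' \<subseteq> acc M `` t \<longrightarrow> supports M t' \<phi> \<longrightarrow> supports M t' \<psi>)"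
| "supports M t (\<phi> \<^bold>\<squnion> \<psi>) \<longleftrightarrow> supports M t \<phi> \<or> supports M t \<psi>"

text \<open>HOL cannot quantify over all types inside a formula, so the type \<open>'w\<close> from which the worlds
  of the models are drawn is a parameter, passed as \<open>TYPE('w)\<close>; \<open>worlds M\<close> ranges over all subsets
  of that type. Entailment over models of every size implies entailment at any particular \<open>'w\<close>,
  so completeness for one fixed \<open>'w\<close> is at least as strong as completeness with respect to the class
  of all models.\<close>

definition entails :: "'w itself \<Rightarrow> 'p form set \<Rightarrow> 'p form \<Rightarrow> bool" where
  "entails _ \<Phi> \<psi> \<longleftrightarrow>
     (\<forall>(M :: ('w, 'p) kripke) t. kripke_model M \<longrightarrow> team M t \<longrightarrow>
        (\<forall>\<phi>\<in>\<Phi>. supports M t \<phi>) \<longrightarrow> supports M t \<psi>)"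


subsection \<open>Natural deduction\<close>

text \<open>Natural deduction in sequent style: \<open>\<Gamma> \<turnstile>\<^sub>N \<phi>\<close> means that there is a derivation of \<open>\<phi>\<close> all of
  whose undischarged assumptions belong to \<open>\<Gamma>\<close>. Subderivations with a discharged assumption may
  use further assumptions, as usual; the restriction in \<open>disjE\<close> is only on the conclusion.\<close>

inductive nd :: "'p form set \<Rightarrow> 'p form \<Rightarrow> bool"  (infix "\<turnstile>\<^sub>N" 50) where
  assm:    "\<phi> \<in> \<Gamma> \<Longrightarrow> \<Gamma> \<turnstile>\<^sub>N \<phi>"
| conjI:   "\<Gamma> \<turnstile>\<^sub>N \<phi> \<Longrightarrow> \<Gamma> \<turnstile>\<^sub>N \<psi> \<Longrightarrow> \<Gamma> \<turnstile>\<^sub>N \<phi> \<^bold>\<and> \<psi>"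
| conjE1:  "\<Gamma> \<turnstile>\<^sub>N \<phi> \<^bold>\<and> \<psi> \<Longrightarrow> \<Gamma> \<turnstile>\<^sub>N \<phi>"
| conjE2:  "\<Gamma> \<turnstile>\<^sub>N \<phi> \<^bold>\<and> \<psi> \<Longrightarrow> \<Gamma> \<turnstile>\<^sub>N \<psi>"
| impI:    "insert \<phi> \<Gamma> \<turnstile>\<^sub>N \<psi> \<Longrightarrow> \<Gamma> \<turnstile>\<^sub>N \<phi> \<^bold>\<rightarrow> \<psi>"
| impE:    "\<Gamma> \<turnstile>\<^sub>N \<phi> \<Longrightarrow> \<Gamma> \<turnstile>\<^sub>N \<phi> \<^bold>\<rightarrow> \<psi> \<Longrightarrow> \<Gamma> \<turnstile>\<^sub>N \<psi>"
| idisjI1: "\<Gamma> \<turnstile>\<^sub>N \<phi> \<Longrightarrow> \<Gamma> \<turnstile>\<^sub>N \<phi> \<^bold>\<squnion> \<psi>"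
| idisjI2: "\<Gamma> \<turnstile>\<^sub>N \<psi> \<Longrightarrow> \<Gamma> \<turnstile>\<^sub>N \<phi> \<^bold>\<squnion> \<psi>"
| idisjE:  "\<Gamma> \<turnstile>\<^sub>N \<phi> \<^bold>\<squnion> \<psi> \<Longrightarrow> insert \<phi> \<Gamma> \<turnstile>\<^sub>N \<chi> \<Longrightarrow> insert \<psi> \<Gamma> \<turnstile>\<^sub>N \<chi> \<Longrightarrow> \<Gamma> \<turnstile>\<^sub>N \<chi>"
| disjI1:  "\<Gamma> \<turnstile>\<^sub>N \<phi> \<Longrightarrow> \<Gamma> \<turnstile>\<^sub>N \<phi> \<^bold>\<or> \<psi>"
| disjI2:  "\<Gamma> \<turnstile>\<^sub>N \<psi> \<Longrightarrow> \<Gamma> \<turnstile>\<^sub>N \<phi> \<^bold>\<or> \<psi>"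
| disjE:   "standard \<alpha> \<Longrightarrow> \<Gamma> \<turnstile>\<^sub>N \<phi> \<^bold>\<or> \<psi> \<Longrightarrow> insert \<phi> \<Gamma> \<turnstile>\<^sub>N \<alpha> \<Longrightarrow> insert \<psi> \<Gamma> \<turnstile>\<^sub>N \<alpha> \<Longrightarrow> \<Gamma> \<turnstile>\<^sub>N \<alpha>"
| disjA:   "\<Gamma> \<turnstile>\<^sub>N \<phi> \<^bold>\<or> (\<psi> \<^bold>\<or> \<chi>) \<Longrightarrow> \<Gamma> \<turnstile>\<^sub>N (\<phi> \<^bold>\<or> \<psi>) \<^bold>\<or> \<chi>"
| disjC:   "\<Gamma> \<turnstile>\<^sub>N \<phi> \<^bold>\<or> \<psi> \<Longrightarrow> \<Gamma> \<turnstile>\<^sub>N \<psi> \<^bold>\<or> \<phi>"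
| disjR:   "\<Gamma> \<turnstile>\<^sub>N \<phi> \<^bold>\<or> \<psi> \<Longrightarrow> insert \<phi> \<Gamma> \<turnstile>\<^sub>N \<phi>' \<Longrightarrow> insert \<psi> \<Gamma> \<turnstile>\<^sub>N \<psi>' \<Longrightarrow> \<Gamma> \<turnstile>\<^sub>N \<phi>' \<^bold>\<or> \<psi>'"
| disjD:   "\<Gamma> \<turnstile>\<^sub>N \<phi> \<^bold>\<or> (\<psi> \<^bold>\<squnion> \<chi>) \<Longrightarrow> \<Gamma> \<turnstile>\<^sub>N (\<phi> \<^bold>\<or> \<psi>) \<^bold>\<squnion> (\<phi> \<^bold>\<or> \<chi>)"
| botE:    "\<Gamma> \<turnstile>\<^sub>N \<bottom>\<^sub>I \<Longrightarrow> \<Gamma> \<turnstile>\<^sub>N \<phi>"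
| split:   "standard \<alpha> \<Longrightarrow> \<Gamma> \<turnstile>\<^sub>N \<alpha> \<^bold>\<rightarrow> (\<phi> \<^bold>\<squnion> \<psi>) \<Longrightarrow> \<Gamma> \<turnstile>\<^sub>N (\<alpha> \<^bold>\<rightarrow> \<phi>) \<^bold>\<squnion> (\<alpha> \<^bold>\<rightarrow> \<psi>)"

definition derives :: "'p form set \<Rightarrow> 'p form \<Rightarrow> bool"  (infix "\<turnstile>\<^sub>I\<^sub>n\<^sub>q\<^sub>I" 50) where
  "\<Phi> \<turnstile>\<^sub>I\<^sub>n\<^sub>q\<^sub>I \<psi> \<longleftrightarrow> (\<exists>\<Gamma>. finite \<Gamma> \<and> \<Gamma> \<subseteq> \<Phi> \<and> \<Gamma> \<turnstile>\<^sub>N \<psi>)"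

end

(*
  Every formula is equivalent to the inquisitive disjunction of its resolutions, which are standard
  formulas; semantically this rests on the flatness of standard formulas, syntactically on the rules
  disjD and split. If Phi does not derive psi, extend Phi to a theory that omits psi and is prime
  for inquisitive disjunction, and let Gamma be its standard part. Gamma contains a resolution of
  every member of Phi, but derives no resolution of psi. The points of the canonical model are the
  consistent theories that are prime for standard disjunction; the team of those which extend Gamma
  supports exactly the standard formulas derivable from Gamma, hence supports Phi but not psi.
*)
theory Submission
  imports Defs
begin

section \<open>Derivability\<close>

lemma nd_mono:
  assumes "\<Gamma> \<turnstile>\<^sub>N \<phi>" "\<Gamma> \<subseteq> \<Delta>"
  shows "\<Delta> \<turnstile>\<^sub>N \<phi>"
  using assms
proof (induction arbitrary: \<Delta> rule: nd.induct)
  case (impI \<phi> \<Gamma> \<psi>)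
  then show ?case by (meson insert_mono nd.impI)
next
  case (idisjE \<Gamma> \<phi> \<psi> \<chi>)
  then show ?case by (meson insert_mono nd.idisjE)
next
  case (disjE \<alpha> \<Gamma> \<phi> \<psi>)
  then show ?case by (meson insert_mono nd.disjE)
next
  case (disjR \<Gamma> \<phi> \<psi> \<phi>' \<psi>')
  then show ?case by (meson insert_mono nd.disjR)
qed (blast intro: nd.intros)+

lemma nd_cut: "\<Gamma> \<turnstile>\<^sub>N \<phi> \<Longrightarrow> insert \<phi> \<Gamma> \<turnstile>\<^sub>N \<psi> \<Longrightarrow> \<Gamma> \<turnstile>\<^sub>N \<psi>"
  using nd.impE nd.impI by blast

section \<open>Compactness of derivability\<close>

lemma derivesI: "\<Gamma> \<turnstile>\<^sub>N \<psi> \<Longrightarrow> finite \<Gamma> \<Longrightarrow> \<Gamma> \<subseteq> \<Phi> \<Longrightarrow> \<Phi> \<turnstile>\<^sub>I\<^sub>n\<^sub>q\<^sub>I \<psi>"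
  by (auto simp: derives_def)

text \<open>Prepares discharging rules: after deleting \<phi> from the finite context and adding it
  back explicitly, what remains lies in \<Phi>.\<close>

lemma derives_insertE:
  assumes "insert \<phi> \<Phi> \<turnstile>\<^sub>I\<^sub>n\<^sub>q\<^sub>I \<psi>"
  obtains \<Gamma> where "finite \<Gamma>" "\<Gamma> \<subseteq> \<Phi>" "insert \<phi> \<Gamma> \<turnstile>\<^sub>N \<psi>"
proof -
  obtain \<Gamma> where "finite \<Gamma>" "\<Gamma> \<subseteq> insert \<phi> \<Phi>" "\<Gamma> \<turnstile>\<^sub>N \<psi>"
    using assms by (auto simp: derives_def)
  then show thesis
    by (intro that[of "\<Gamma> - {\<phi>}"]) (auto elim: nd_mono)
qed

lemma derives_finite2:
  assumes "\<Phi> \<turnstile>\<^sub>I\<^sub>n\<^sub>q\<^sub>I \<phi>" "\<Phi> \<turnstile>\<^sub>I\<^sub>n\<^sub>q\<^sub>I \<psi>"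
  obtains \<Gamma> where "finite \<Gamma>" "\<Gamma> \<subseteq> \<Phi>" "\<Gamma> \<turnstile>\<^sub>N \<phi>" "\<Gamma> \<turnstile>\<^sub>N \<psi>"
proof -
  obtain \<Gamma> \<Delta> where "finite \<Gamma>" "\<Gamma> \<subseteq> \<Phi>" "\<Gamma> \<turnstile>\<^sub>N \<phi>" "finite \<Delta>" "\<Delta> \<subseteq> \<Phi>" "\<Delta> \<turnstile>\<^sub>N \<psi>"
    using assms by (auto simp: derives_def)
  then show thesis
    by (intro that[of "\<Gamma> \<union> \<Delta>"]) (auto elim: nd_mono)
qed

text \<open>Shaped after the premises of \<open>idisjE\<close>, \<open>disjE\<close> and
  \<open>disjR\<close>: by weakening, the union of three finite contexts serves all three
  derivations.\<close>

lemma derives_finite3: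
  assumes "\<Phi> \<turnstile>\<^sub>I\<^sub>n\<^sub>q\<^sub>I \<chi>" "insert \<phi> \<Phi> \<turnstile>\<^sub>I\<^sub>n\<^sub>q\<^sub>I \<phi>'" "insert \<psi> \<Phi> \<turnstile>\<^sub>I\<^sub>n\<^sub>q\<^sub>I \<psi>'"
  obtains \<Gamma> where "finite \<Gamma>" "\<Gamma> \<subseteq> \<Phi>" "\<Gamma> \<turnstile>\<^sub>N \<chi>" "insert \<phi> \<Gamma> \<turnstile>\<^sub>N \<phi>'" "insert \<psi> \<Gamma> \<turnstile>\<^sub>N \<psi>'"
proof -
  obtain \<Gamma> where \<Gamma>: "finite \<Gamma>" "\<Gamma> \<subseteq> \<Phi>" "\<Gamma> \<turnstile>\<^sub>N \<chi>"
    using assms(1) by (auto simp: derives_def)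
  obtain \<Gamma>' where \<Gamma>': "finite \<Gamma>'" "\<Gamma>' \<subseteq> \<Phi>" "insert \<phi> \<Gamma>' \<turnstile>\<^sub>N \<phi>'"
    using assms(2) by (rule derives_insertE)
  obtain \<Gamma>'' where \<Gamma>'': "finite \<Gamma>''" "\<Gamma>'' \<subseteq> \<Phi>" "insert \<psi> \<Gamma>'' \<turnstile>\<^sub>N \<psi>'"
    using assms(3) by (rule derives_insertE)
  show thesis
    using \<Gamma> \<Gamma>' \<Gamma>'' by (intro that[of "\<Gamma> \<union> \<Gamma>' \<union> \<Gamma>''"]) (auto elim!: nd_mono)
qed

text \<open>Contexts of \<open>nd\<close> may be infinite, but each rule has finitely many premises,
  so finite contexts can be merged rule by rule. This makes unions of chains work in the Lindenbaum
  argument.\<close>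

lemma nd_compact: "\<Phi> \<turnstile>\<^sub>N \<psi> \<Longrightarrow> \<Phi> \<turnstile>\<^sub>I\<^sub>n\<^sub>q\<^sub>I \<psi>"
proof (induction rule: nd.induct)
  case (assm \<phi> \<Gamma>)
  then show ?case by (intro derivesI[of "{\<phi>}"]) (auto intro: nd.assm)
next
  case (conjI \<Gamma> \<phi> \<psi>)
  then show ?case by (meson derives_finite2 derivesI nd.conjI)
next
  case (impI \<phi> \<Gamma> \<psi>)
  then show ?case by (meson derives_insertE derivesI nd.impI)
next
  case (impE \<Gamma> \<phi> \<psi>)
  then show ?case by (meson derives_finite2 derivesI nd.impE)
next
  case (idisjE \<Gamma> \<phi> \<psi> \<chi>)
  from idisjE.IH show ?case by (rule derives_finite3) (blast intro: derivesI nd.idisjE)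
next
  case (disjE \<alpha> \<Gamma> \<phi> \<psi>)
  from disjE.IH show ?case
    by (rule derives_finite3) (blast intro: derivesI nd.disjE disjE.hyps(1))
next
  case (disjR \<Gamma> \<phi> \<psi> \<phi>' \<psi>')
  from disjR.IH show ?case by (rule derives_finite3) (blast intro: derivesI nd.disjR)
qed (auto simp: derives_def intro: nd.intros)


section \<open>Theories and the Lindenbaum lemma\<close>

definition theory_closed :: "'p form set \<Rightarrow> bool" where
  "theory_closed \<Delta> \<longleftrightarrow> (\<forall>\<phi>. \<Delta> \<turnstile>\<^sub>N \<phi> \<longrightarrow> \<phi> \<in> \<Delta>)"

definition idisj_prime :: "'p form set \<Rightarrow> bool" where
  "idisj_prime \<Delta> \<longleftrightarrow> (\<forall>\<phi> \<psi>. \<phi> \<^bold>\<squnion> \<psi> \<in> \<Delta> \<longrightarrow> \<phi> \<in> \<Delta> \<or> \<psi> \<in> \<Delta>)"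

definition disj_prime :: "'p form set \<Rightarrow> bool" where
  "disj_prime \<Delta> \<longleftrightarrow> (\<forall>\<phi> \<psi>. \<phi> \<^bold>\<or> \<psi> \<in> \<Delta> \<longrightarrow> \<phi> \<in> \<Delta> \<or> \<psi> \<in> \<Delta>)"

lemma closed_nd_iff: "theory_closed \<Delta> \<Longrightarrow> \<Delta> \<turnstile>\<^sub>N \<phi> \<longleftrightarrow> \<phi> \<in> \<Delta>"
  by (auto simp: theory_closed_def intro: nd.assm)

lemma closedD: "theory_closed \<Delta> \<Longrightarrow> \<Delta> \<turnstile>\<^sub>N \<phi> \<Longrightarrow> \<phi> \<in> \<Delta>"
  by (simp add: closed_nd_iff)

lemma closed_entailed: "theory_closed \<Delta> \<Longrightarrow> \<phi> \<in> \<Delta> \<Longrightarrow> {\<phi>} \<turnstile>\<^sub>N \<psi> \<Longrightarrow> \<psi> \<in> \<Delta>"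
  by (rule closedD) (auto elim: nd_mono)

lemma closed_top: "theory_closed \<Delta> \<Longrightarrow> \<bottom>\<^sub>I \<^bold>\<rightarrow> \<bottom>\<^sub>I \<in> \<Delta>"
  by (blast intro: closedD nd.impI nd.assm)

lemma closed_conj_iff: "theory_closed \<Delta> \<Longrightarrow> \<phi> \<^bold>\<and> \<psi> \<in> \<Delta> \<longleftrightarrow> \<phi> \<in> \<Delta> \<and> \<psi> \<in> \<Delta>"
  by (metis closed_nd_iff nd.conjI nd.conjE1 nd.conjE2)

lemma closed_imp_iff: "theory_closed \<Delta> \<Longrightarrow> \<phi> \<^bold>\<rightarrow> \<psi> \<in> \<Delta> \<longleftrightarrow> insert \<phi> \<Delta> \<turnstile>\<^sub>N \<psi>"
  by (metis closed_nd_iff insertI1 nd.assm nd.impE nd.impI nd_mono subset_insertI)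

lemma closed_disjI:
  "theory_closed \<Delta> \<Longrightarrow> \<phi> \<in> \<Delta> \<or> \<psi> \<in> \<Delta> \<Longrightarrow> \<phi> \<^bold>\<or> \<psi> \<in> \<Delta>"
  by (metis closed_nd_iff nd.disjI1 nd.disjI2)

lemma closed_disj_mono:
  assumes "theory_closed \<Delta>" "\<phi> \<^bold>\<or> \<psi> \<in> \<Delta>" "{\<phi>} \<turnstile>\<^sub>N \<phi>'" "{\<psi>} \<turnstile>\<^sub>N \<psi>'"
  shows "\<phi>' \<^bold>\<or> \<psi>' \<in> \<Delta>"
proof (rule closedD[OF assms(1)], rule nd.disjR)
  show "\<Delta> \<turnstile>\<^sub>N \<phi> \<^bold>\<or> \<psi>" using assms(2) by (rule nd.assm)
qed (use assms in \<open>auto elim: nd_mono\<close>)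

lemma closed_idisj_iff:
  "theory_closed \<Delta> \<Longrightarrow> idisj_prime \<Delta> \<Longrightarrow> \<phi> \<^bold>\<squnion> \<psi> \<in> \<Delta> \<longleftrightarrow> \<phi> \<in> \<Delta> \<or> \<psi> \<in> \<Delta>"
  by (metis closed_nd_iff idisj_prime_def nd.idisjI1 nd.idisjI2)

text \<open>Take a maximal extension that does not derive \<chi>. If both disjuncts of a member were
  missing, adding either one would yield \<chi> by maximality, and the elimination rule would then
  derive \<chi>. For \<or> that rule needs a standard conclusion, hence the condition on
  \<chi>.\<close>

lemma lindenbaum:
  assumes "\<not> \<Gamma> \<turnstile>\<^sub>N \<chi>"
  obtains \<Delta> where "\<Gamma> \<subseteq> \<Delta>" "\<chi> \<notin> \<Delta>" "theory_closed \<Delta>" "idisj_prime \<Delta>"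
    "standard \<chi> \<Longrightarrow> disj_prime \<Delta>"
proof -
  define A where "A = {\<Delta>. \<Gamma> \<subseteq> \<Delta> \<and> \<not> \<Delta> \<turnstile>\<^sub>N \<chi>}"
  have "\<exists>\<Delta>\<in>A. \<forall>X\<in>A. \<Delta> \<subseteq> X \<longrightarrow> X = \<Delta>"
  proof (rule subset_Zorn_nonempty)
    show "A \<noteq> {}" using assms by (auto simp: A_def)
  next
    fix C assume C: "C \<noteq> {}" "subset.chain A C"
    \<comment> \<open>A derivation from the union uses finitely many assumptions, which already lie
      together in one member of the chain.\<close>
    have "\<not> \<Union>C \<turnstile>\<^sub>N \<chi>"
    proof
      assume "\<Union>C \<turnstile>\<^sub>N \<chi>"
      then obtain F where F: "finite F" "F \<subseteq> \<Union>C" "F \<turnstile>\<^sub>N \<chi>"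
        using nd_compact[of "\<Union>C" \<chi>] unfolding derives_def by blast
      obtain X where "X \<in> C" "F \<subseteq> X"
        using finite_subset_Union_chain[OF F(1,2) C] .
      then have "\<not> X \<turnstile>\<^sub>N \<chi>" using C(2) by (auto simp: A_def subset.chain_def)
      then show False using F(3) \<open>F \<subseteq> X\<close> nd_mono by blast
    qed
    moreover have "\<Gamma> \<subseteq> \<Union>C"
    proof -
      obtain X where "X \<in> C" using C(1) by blast
      then have "X \<in> A" using C(2) by (auto simp: subset.chain_def)
      with \<open>X \<in> C\<close> show ?thesis by (auto simp: A_def)
    qed
    ultimately show "\<Union>C \<in> A" by (simp add: A_def)
  qed
  then obtain \<Delta> where "\<Delta> \<in> A" and max: "\<And>X. X \<in> A \<Longrightarrow> \<Delta> \<subseteq> X \<Longrightarrow> X = \<Delta>"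
    by metis
  then have \<Delta>: "\<Gamma> \<subseteq> \<Delta>" "\<not> \<Delta> \<turnstile>\<^sub>N \<chi>" by (simp_all add: A_def)
  have ins: "insert \<phi> \<Delta> \<turnstile>\<^sub>N \<chi>" if "\<phi> \<notin> \<Delta>" for \<phi>
    using max[of "insert \<phi> \<Delta>"] that \<Delta>(1) unfolding A_def by blast
  show thesis
  proof
    show "\<Gamma> \<subseteq> \<Delta>" by fact
    show "\<chi> \<notin> \<Delta>" using \<Delta>(2) nd.assm by blast
    show "theory_closed \<Delta>"
      unfolding theory_closed_def using \<Delta>(2) ins nd_cut by blast
    show "idisj_prime \<Delta>"
      unfolding idisj_prime_def using \<Delta>(2) ins nd.idisjE nd.assm by metis
    show "disj_prime \<Delta>" if "standard \<chi>"
      unfolding disj_prime_def using \<Delta>(2) ins nd.disjE[OF that] nd.assm by metis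
  qed
qed


section \<open>Resolutions\<close>

text \<open>Conjunctions of implications \<open>\<alpha> \<^bold>\<rightarrow> f \<alpha>\<close>, one for every \<open>\<alpha>\<close> in the first list, where \<open>f\<close> ranges
  over the choices of members of the second; \<open>\<bottom>\<^sub>I \<^bold>\<rightarrow> \<bottom>\<^sub>I\<close> is the empty conjunction.\<close>

primrec imp_choices :: "'p form list \<Rightarrow> 'p form list \<Rightarrow> 'p form list" where
  "imp_choices [] bs = [\<bottom>\<^sub>I \<^bold>\<rightarrow> \<bottom>\<^sub>I]"
| "imp_choices (a # as) bs = [(a \<^bold>\<rightarrow> b) \<^bold>\<and> c. b \<leftarrow> bs, c \<leftarrow> imp_choices as bs]"

text \<open>The list collects the disjuncts of an inquisitive normal form. A resolution of an
  implication fixes, for each resolution of the antecedent, the resolution of the consequent that it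
  leads to.\<close>

primrec resolutions :: "'p form \<Rightarrow> 'p form list" where
  "resolutions (Atom p) = [Atom p]"
| "resolutions \<bottom>\<^sub>I = [\<bottom>\<^sub>I]"
| "resolutions (\<phi> \<^bold>\<and> \<psi>) = [\<alpha> \<^bold>\<and> \<beta>. \<alpha> \<leftarrow> resolutions \<phi>, \<beta> \<leftarrow> resolutions \<psi>]"
| "resolutions (\<phi> \<^bold>\<or> \<psi>) = [\<alpha> \<^bold>\<or> \<beta>. \<alpha> \<leftarrow> resolutions \<phi>, \<beta> \<leftarrow> resolutions \<psi>]"
| "resolutions (\<phi> \<^bold>\<rightarrow> \<psi>) = imp_choices (resolutions \<phi>) (resolutions \<psi>)"
| "resolutions (\<phi> \<^bold>\<squnion> \<psi>) = resolutions \<phi> @ resolutions \<psi>"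

lemma imp_choices_ne: "bs \<noteq> [] \<Longrightarrow> imp_choices as bs \<noteq> []"
  by (induction as) (auto simp: neq_Nil_conv)

lemma resolutions_ne: "resolutions \<phi> \<noteq> []"
  by (induction \<phi>) (auto simp: neq_Nil_conv imp_choices_ne)

lemma imp_choices_standard:
  "\<forall>a\<in>set as. standard a \<Longrightarrow> \<forall>b\<in>set bs. standard b \<Longrightarrow> c \<in> set (imp_choices as bs) \<Longrightarrow> standard c"
  by (induction as arbitrary: c) auto

lemma resolutions_standard: "\<alpha> \<in> set (resolutions \<phi>) \<Longrightarrow> standard \<alpha>"
proof (induction \<phi> arbitrary: \<alpha>)
  case (Imp \<phi> \<psi>)
  then show ?case using imp_choices_standard[of "resolutions \<phi>" "resolutions \<psi>"] by simp
qed auto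

text \<open>A finite choice principle: picking a value separately for each argument amounts to
  picking one choice function. Abstracting over \<open>P\<close> lets it serve both membership in a
  theory and support by a team.\<close>

lemma ex_imp_choices_iff:
  assumes "P (\<bottom>\<^sub>I \<^bold>\<rightarrow> \<bottom>\<^sub>I)" "\<And>\<phi> \<psi>. P (\<phi> \<^bold>\<and> \<psi>) \<longleftrightarrow> P \<phi> \<and> P \<psi>"
  shows "(\<exists>c\<in>set (imp_choices as bs). P c) \<longleftrightarrow> (\<forall>a\<in>set as. \<exists>b\<in>set bs. P (a \<^bold>\<rightarrow> b))"
  using assms by (induction as) auto

section \<open>Resolutions as a provable normal form\<close>

primrec big_idisj :: "'p form list \<Rightarrow> 'p form" where
  "big_idisj [] = \<bottom>\<^sub>I"
| "big_idisj (a # as) = a \<^bold>\<squnion> big_idisj as"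

lemma nd_big_idisjI: "a \<in> set as \<Longrightarrow> \<Gamma> \<turnstile>\<^sub>N a \<Longrightarrow> \<Gamma> \<turnstile>\<^sub>N big_idisj as"
  by (induction as) (auto intro: nd.idisjI1 nd.idisjI2)

lemma distribute_big_idisj:
  assumes "C (big_idisj as) \<in> \<Delta>" "as \<noteq> []"
    and mono: "\<And>a b. {a} \<turnstile>\<^sub>N b \<Longrightarrow> C a \<in> \<Delta> \<Longrightarrow> C b \<in> \<Delta>"
    and distrib: "\<And>a b. C (a \<^bold>\<squnion> b) \<in> \<Delta> \<Longrightarrow> C a \<in> \<Delta> \<or> C b \<in> \<Delta>"
  shows "\<exists>a\<in>set as. C a \<in> \<Delta>"
  using assms(1,2)
proof (induction as)
  case (Cons a as)
  show ?case
  proof (cases "as = []")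
    case True
    \<comment> \<open>\<open>big_idisj\<close> always ends in \<open>\<bottom>\<^sub>I\<close>;
      since that entails the last genuine member, \<open>mono\<close> absorbs the surplus
      disjunct.\<close>
    have "{\<bottom>\<^sub>I} \<turnstile>\<^sub>N a" by (simp add: nd.assm nd.botE)
    then show ?thesis using True Cons.prems(1) distrib[of a "\<bottom>\<^sub>I"] mono by auto
  next
    case False
    then show ?thesis using Cons distrib by auto
  qed
qed simp

text \<open>The assumption is one direction of \<open>closed_resolutions_iff\<close> for a single
  \<phi>, so the induction hypothesis there can be turned into a derivation. A failure would give a
  prime theory with \<phi> but with no resolution of it.\<close>

lemma nd_big_idisj_resolutions:
  assumes "\<And>\<Delta>. theory_closed \<Delta> \<Longrightarrow> idisj_prime \<Delta> \<Longrightarrow> \<phi> \<in> \<Delta> \<Longrightarrow>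
    \<exists>\<alpha>\<in>set (resolutions \<phi>). \<alpha> \<in> \<Delta>"
  shows "{\<phi>} \<turnstile>\<^sub>N big_idisj (resolutions \<phi>)"
proof (rule ccontr)
  assume "\<not> ?thesis"
  then obtain \<Delta> where \<Delta>: "{\<phi>} \<subseteq> \<Delta>" "big_idisj (resolutions \<phi>) \<notin> \<Delta>"
    "theory_closed \<Delta>" "idisj_prime \<Delta>"
    by (rule lindenbaum)
  then obtain \<alpha> where "\<alpha> \<in> set (resolutions \<phi>)" "\<alpha> \<in> \<Delta>" using assms by blast
  then show False using \<Delta>(2,3) by (meson closed_nd_iff nd_big_idisjI)
qed

lemma nd_via_prime_theories:
  assumes "\<And>\<Delta>. theory_closed \<Delta> \<Longrightarrow> idisj_prime \<Delta> \<Longrightarrow> \<alpha> \<in> \<Delta> \<Longrightarrow> \<phi> \<in> \<Delta>"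
  shows "{\<alpha>} \<turnstile>\<^sub>N \<phi>"
proof (rule ccontr)
  assume "\<not> ?thesis"
  then obtain \<Delta> where "{\<alpha>} \<subseteq> \<Delta>" "\<phi> \<notin> \<Delta>" "theory_closed \<Delta>" "idisj_prime \<Delta>"
    by (rule lindenbaum)
  then show False using assms by blast
qed

text \<open>In a prime theory inquisitive disjunction is decided, so it suffices to pull it outwards
  through \<or> by \<open>disjD\<close> and through implications with standard antecedent by
  \<open>split\<close>. The theory varies in the induction because derivability between a component
  and its resolutions is obtained by looking at all prime theories.\<close>

lemma closed_resolutions_iff:
  assumes "theory_closed \<Delta>" "idisj_prime \<Delta>"
  shows "\<phi> \<in> \<Delta> \<longleftrightarrow> (\<exists>\<alpha>\<in>set (resolutions \<phi>). \<alpha> \<in> \<Delta>)"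
  using assms
proof (induction \<phi> arbitrary: \<Delta>)
  case (Conj \<phi> \<psi>)
  then show ?case by (auto simp: closed_conj_iff)
next
  case (IDisj \<phi> \<psi>)
  then show ?case by (auto simp: closed_idisj_iff)
next
  case (Disj \<phi> \<psi>)
  note closed = Disj.prems(1) and prime = Disj.prems(2)
  have nd_\<phi>: "{\<phi>} \<turnstile>\<^sub>N big_idisj (resolutions \<phi>)"
    using Disj.IH(1) by (intro nd_big_idisj_resolutions) blast
  have nd_\<psi>: "{\<psi>} \<turnstile>\<^sub>N big_idisj (resolutions \<psi>)"
    using Disj.IH(2) by (intro nd_big_idisj_resolutions) blast
  have refl: "{\<chi>} \<turnstile>\<^sub>N \<chi>" for \<chi> :: "'a form" by (simp add: nd.assm)
  have comm: "b \<^bold>\<or> a \<in> \<Delta>" if "a \<^bold>\<or> b \<in> \<Delta>" for a b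
    using that closed by (metis closed_nd_iff nd.disjC)
  have distrib: "\<exists>b\<in>set bs. a \<^bold>\<or> b \<in> \<Delta>" if "a \<^bold>\<or> big_idisj bs \<in> \<Delta>" "bs \<noteq> []" for a bs
  proof (rule distribute_big_idisj[where C = "\<lambda>b. a \<^bold>\<or> b", OF that])
    show "a \<^bold>\<or> c \<in> \<Delta>" if "{b} \<turnstile>\<^sub>N c" "a \<^bold>\<or> b \<in> \<Delta>" for b c
      using closed_disj_mono[OF closed that(2) refl that(1)] .
    show "a \<^bold>\<or> b \<in> \<Delta> \<or> a \<^bold>\<or> c \<in> \<Delta>" if "a \<^bold>\<or> (b \<^bold>\<squnion> c) \<in> \<Delta>" for b c
      using that closed prime by (metis closed_nd_iff closed_idisj_iff nd.disjD)
  qed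
  show ?case
  proof
    \<comment> \<open>\<open>disjD\<close> distributes over the right disjunct only, so \<psi> is
      resolved first, then the disjuncts are swapped and \<phi> is resolved.\<close>
    assume "\<phi> \<^bold>\<or> \<psi> \<in> \<Delta>"
    then have "\<phi> \<^bold>\<or> big_idisj (resolutions \<psi>) \<in> \<Delta>"
      using closed_disj_mono[OF closed _ refl nd_\<psi>] by blast
    then obtain \<beta> where \<beta>: "\<beta> \<in> set (resolutions \<psi>)" "\<beta> \<^bold>\<or> \<phi> \<in> \<Delta>"
      using distrib resolutions_ne comm by blast
    then have "\<beta> \<^bold>\<or> big_idisj (resolutions \<phi>) \<in> \<Delta>"
      using closed_disj_mono[OF closed _ refl nd_\<phi>] by blast
    then obtain \<alpha> where "\<alpha> \<in> set (resolutions \<phi>)" "\<alpha> \<^bold>\<or> \<beta> \<in> \<Delta>"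
      using distrib resolutions_ne comm by blast
    with \<beta> show "\<exists>\<alpha>\<in>set (resolutions (\<phi> \<^bold>\<or> \<psi>)). \<alpha> \<in> \<Delta>" by auto
  next
    assume "\<exists>\<alpha>\<in>set (resolutions (\<phi> \<^bold>\<or> \<psi>)). \<alpha> \<in> \<Delta>"
    then obtain \<alpha> \<beta> where *: "\<alpha> \<in> set (resolutions \<phi>)" "\<beta> \<in> set (resolutions \<psi>)" "\<alpha> \<^bold>\<or> \<beta> \<in> \<Delta>"
      by auto
    have "{\<alpha>} \<turnstile>\<^sub>N \<phi>" using *(1) Disj.IH(1) by (intro nd_via_prime_theories) blast
    moreover have "{\<beta>} \<turnstile>\<^sub>N \<psi>" using *(2) Disj.IH(2) by (intro nd_via_prime_theories) blast
    ultimately show "\<phi> \<^bold>\<or> \<psi> \<in> \<Delta>" using closed_disj_mono[OF closed *(3)] by blast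
  qed
next
  case (Imp \<phi> \<psi>)
  note closed = Imp.prems(1) and prime = Imp.prems(2)
  have nd_\<psi>: "{\<psi>} \<turnstile>\<^sub>N big_idisj (resolutions \<psi>)"
    using Imp.IH(2) by (intro nd_big_idisj_resolutions) blast
  have mono: "a \<^bold>\<rightarrow> c \<in> \<Delta>" if "{b} \<turnstile>\<^sub>N c" "a \<^bold>\<rightarrow> b \<in> \<Delta>" for a b c
  proof -
    have "insert b (insert a \<Delta>) \<turnstile>\<^sub>N c" using that(1) by (rule nd_mono) simp
    then show ?thesis using that(2) closed by (meson closed_imp_iff nd_cut)
  qed
  have "\<phi> \<^bold>\<rightarrow> \<psi> \<in> \<Delta> \<longleftrightarrow> (\<forall>\<alpha>\<in>set (resolutions \<phi>). \<exists>\<beta>\<in>set (resolutions \<psi>). \<alpha> \<^bold>\<rightarrow> \<beta> \<in> \<Delta>)"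
  proof (intro iffI ballI)
    fix \<alpha> assume imp: "\<phi> \<^bold>\<rightarrow> \<psi> \<in> \<Delta>" and \<alpha>: "\<alpha> \<in> set (resolutions \<phi>)"
    have "{\<alpha>} \<turnstile>\<^sub>N \<phi>" using \<alpha> Imp.IH(1) by (intro nd_via_prime_theories) blast
    then have "insert \<alpha> \<Delta> \<turnstile>\<^sub>N \<phi>" by (rule nd_mono) simp
    moreover have "insert \<alpha> \<Delta> \<turnstile>\<^sub>N \<phi> \<^bold>\<rightarrow> \<psi>" using imp by (simp add: nd.assm)
    ultimately have "insert \<alpha> \<Delta> \<turnstile>\<^sub>N \<psi>" by (rule nd.impE)
    then have "\<alpha> \<^bold>\<rightarrow> \<psi> \<in> \<Delta>" using closed by (simp add: closed_imp_iff)
    then have "\<alpha> \<^bold>\<rightarrow> big_idisj (resolutions \<psi>) \<in> \<Delta>" by (rule mono[OF nd_\<psi>])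
    then show "\<exists>\<beta>\<in>set (resolutions \<psi>). \<alpha> \<^bold>\<rightarrow> \<beta> \<in> \<Delta>"
    proof (rule distribute_big_idisj[where C = "\<lambda>b. \<alpha> \<^bold>\<rightarrow> b", OF _ resolutions_ne])
      show "\<alpha> \<^bold>\<rightarrow> b \<in> \<Delta> \<or> \<alpha> \<^bold>\<rightarrow> c \<in> \<Delta>" if "\<alpha> \<^bold>\<rightarrow> (b \<^bold>\<squnion> c) \<in> \<Delta>" for b c
      proof -
        have "\<Delta> \<turnstile>\<^sub>N (\<alpha> \<^bold>\<rightarrow> b) \<^bold>\<squnion> (\<alpha> \<^bold>\<rightarrow> c)"
          using that by (intro nd.split nd.assm resolutions_standard[OF \<alpha>])
        then show ?thesis using closed prime by (simp add: closed_nd_iff closed_idisj_iff)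
      qed
    qed (rule mono)
  next
    assume *: "\<forall>\<alpha>\<in>set (resolutions \<phi>). \<exists>\<beta>\<in>set (resolutions \<psi>). \<alpha> \<^bold>\<rightarrow> \<beta> \<in> \<Delta>"
    have "insert \<phi> \<Delta> \<turnstile>\<^sub>N \<psi>"
    \<comment> \<open>Any prime extension containing \<phi> settles on one resolution \<alpha> of
      it, and the implication chosen for that \<alpha> delivers \<psi>.\<close>
    proof (rule ccontr)
      assume "\<not> insert \<phi> \<Delta> \<turnstile>\<^sub>N \<psi>"
      then obtain \<Delta>' where \<Delta>': "insert \<phi> \<Delta> \<subseteq> \<Delta>'" "\<psi> \<notin> \<Delta>'" "theory_closed \<Delta>'" "idisj_prime \<Delta>'"
        by (rule lindenbaum)
      then obtain \<alpha> where \<alpha>: "\<alpha> \<in> set (resolutions \<phi>)" "\<alpha> \<in> \<Delta>'" using Imp.IH(1) by blast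
      then obtain \<beta> where \<beta>: "\<beta> \<in> set (resolutions \<psi>)" "\<alpha> \<^bold>\<rightarrow> \<beta> \<in> \<Delta>'" using * \<Delta>'(1) by blast
      then have "\<beta> \<in> \<Delta>'" using \<alpha> \<Delta>'(3) by (meson closed_nd_iff nd.impE)
      then show False using \<beta> \<Delta>' Imp.IH(2) by blast
    qed
    then show "\<phi> \<^bold>\<rightarrow> \<psi> \<in> \<Delta>" using closed by (simp add: closed_imp_iff)
  qed
  then show ?case
    using ex_imp_choices_iff[of "\<lambda>\<chi>. \<chi> \<in> \<Delta>"] closed by (simp add: closed_top closed_conj_iff)
qed simp_all

lemma resolution_nd: "\<alpha> \<in> set (resolutions \<phi>) \<Longrightarrow> {\<alpha>} \<turnstile>\<^sub>N \<phi>"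
  using closed_resolutions_iff by (intro nd_via_prime_theories) blast


section \<open>Support of standard formulas and resolutions\<close>

text \<open>Without inquisitive disjunction each clause reduces to a condition on single worlds: a
  team is split for \<or> by sorting its worlds, and the image of a team under the order is the
  union of the images of its singletons.\<close>

lemma supports_standard_flat:
  "standard \<alpha> \<Longrightarrow> supports M t \<alpha> \<longleftrightarrow> (\<forall>w\<in>t. supports M {w} \<alpha>)"
proof (induction \<alpha> arbitrary: t)
  case (Conj \<alpha> \<beta>)
  then have std: "standard \<alpha>" "standard \<beta>" by auto
  show ?case
    unfolding supports.simps Conj.IH(1)[OF std(1), of t] Conj.IH(2)[OF std(2), of t] by blast
next
  case (Disj \<alpha> \<beta>)
  then have std: "standard \<alpha>" "standard \<beta>" by auto
  note IH = Disj.IH(1)[OF std(1)] Disj.IH(2)[OF std(2)]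
  \<comment> \<open>The right side is checked world by world; comparing its instances at
    \<open>t\<close> and at singletons gives flatness.\<close>
  have split_iff: "supports M s (\<alpha> \<^bold>\<or> \<beta>) \<longleftrightarrow> (\<forall>w\<in>s. supports M {w} \<alpha> \<or> supports M {w} \<beta>)" for s
  proof
    assume "supports M s (\<alpha> \<^bold>\<or> \<beta>)"
    then obtain s' s'' where "s = s' \<union> s''" "supports M s' \<alpha>" "supports M s'' \<beta>" by auto
    then show "\<forall>w\<in>s. supports M {w} \<alpha> \<or> supports M {w} \<beta>"
      using IH(1)[of s'] IH(2)[of s''] by blast
  next
    assume "\<forall>w\<in>s. supports M {w} \<alpha> \<or> supports M {w} \<beta>"
    then have "s = {w\<in>s. supports M {w} \<alpha>} \<union> {w\<in>s. supports M {w} \<beta>}" by blast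
    moreover have "supports M {w\<in>s. supports M {w} \<alpha>} \<alpha>" by (subst IH(1)) simp
    moreover have "supports M {w\<in>s. supports M {w} \<beta>} \<beta>" by (subst IH(2)) simp
    ultimately show "supports M s (\<alpha> \<^bold>\<or> \<beta>)" unfolding supports.simps by blast
  qed
  show ?case by (simp only: split_iff ball_simps singleton_iff) blast
next
  case (Imp \<alpha> \<beta>)
  then have std: "standard \<alpha>" "standard \<beta>" by auto
  note IH = Imp.IH(1)[OF std(1)] Imp.IH(2)[OF std(2)]
  have imp_iff: "supports M s (\<alpha> \<^bold>\<rightarrow> \<beta>) \<longleftrightarrow>
    (\<forall>w\<in>acc M `` s. supports M {w} \<alpha> \<longrightarrow> supports M {w} \<beta>)" for s
  proof
    assume "supports M s (\<alpha> \<^bold>\<rightarrow> \<beta>)"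
    then show "\<forall>w\<in>acc M `` s. supports M {w} \<alpha> \<longrightarrow> supports M {w} \<beta>" by simp
  next
    assume "\<forall>w\<in>acc M `` s. supports M {w} \<alpha> \<longrightarrow> supports M {w} \<beta>"
    then show "supports M s (\<alpha> \<^bold>\<rightarrow> \<beta>)"
      unfolding supports.simps using IH by (meson subsetD)
  qed
  show ?case by (simp only: imp_iff) blast
qed auto

lemma supports_standard_subset:
  "standard \<alpha> \<Longrightarrow> supports M t \<alpha> \<Longrightarrow> s \<subseteq> t \<Longrightarrow> supports M s \<alpha>"
  by (metis subsetD supports_standard_flat)

text \<open>Semantic counterpart of \<open>closed_resolutions_iff\<close>, with flatness of the
  antecedent's resolutions in the role of \<open>split\<close>.\<close>

lemma supports_resolutions_iff:
  "supports M t \<phi> \<longleftrightarrow> (\<exists>\<alpha>\<in>set (resolutions \<phi>). supports M t \<alpha>)"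
proof (induction \<phi> arbitrary: t)
  case (Disj \<phi> \<psi>)
  have "supports M t (\<phi> \<^bold>\<or> \<psi>) \<longleftrightarrow>
    (\<exists>\<alpha>\<in>set (resolutions \<phi>). \<exists>\<beta>\<in>set (resolutions \<psi>). supports M t (\<alpha> \<^bold>\<or> \<beta>))"
    unfolding supports.simps Disj.IH(1) Disj.IH(2) by blast
  then show ?case by auto
next
  case (Imp \<phi> \<psi>)
  have "supports M t (\<phi> \<^bold>\<rightarrow> \<psi>) \<longleftrightarrow>
    (\<forall>\<alpha>\<in>set (resolutions \<phi>). \<exists>\<beta>\<in>set (resolutions \<psi>). supports M t (\<alpha> \<^bold>\<rightarrow> \<beta>))"
  proof (intro iffI ballI)
    fix \<alpha> assume imp: "supports M t (\<phi> \<^bold>\<rightarrow> \<psi>)" and \<alpha>: "\<alpha> \<in> set (resolutions \<phi>)"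
    note std = resolutions_standard[OF \<alpha>]
    \<comment> \<open>By flatness \<open>s\<close> is the largest subteam of the image that supports
      \<alpha>. A resolution \<beta> found for \<open>s\<close> passes to all its subteams, so one
      \<beta> works uniformly.\<close>
    define s where "s = {w \<in> acc M `` t. supports M {w} \<alpha>}"
    have s: "s \<subseteq> acc M `` t" by (auto simp: s_def)
    have "supports M s \<alpha>" by (subst supports_standard_flat[OF std]) (simp add: s_def)
    then have "supports M s \<phi>" using \<alpha> Imp.IH(1) by blast
    then have "supports M s \<psi>" using imp s by simp
    then obtain \<beta> where \<beta>: "\<beta> \<in> set (resolutions \<psi>)" "supports M s \<beta>" using Imp.IH(2) by blast
    have "t' \<subseteq> s" if "t' \<subseteq> acc M `` t" "supports M t' \<alpha>" for t'
      using that supports_standard_flat[OF std, of M t'] unfolding s_def by blast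
    then have "supports M t (\<alpha> \<^bold>\<rightarrow> \<beta>)"
      using \<beta> resolutions_standard supports_standard_subset by (metis supports.simps(5))
    with \<beta> show "\<exists>\<beta>\<in>set (resolutions \<psi>). supports M t (\<alpha> \<^bold>\<rightarrow> \<beta>)" by blast
  next
    assume "\<forall>\<alpha>\<in>set (resolutions \<phi>). \<exists>\<beta>\<in>set (resolutions \<psi>). supports M t (\<alpha> \<^bold>\<rightarrow> \<beta>)"
    then show "supports M t (\<phi> \<^bold>\<rightarrow> \<psi>)"
      unfolding supports.simps Imp.IH(1) Imp.IH(2) by metis
  qed
  then show ?case
    using ex_imp_choices_iff[of "supports M t"] by simp
qed auto


section \<open>The canonical model\<close>

text \<open>Worlds are theories in the full language, prime for \<or> because standard formulas will
  be evaluated at single worlds. Excluding \<open>\<bottom>\<^sub>I\<close> matches its support by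
  the empty team alone.\<close>

definition canonical :: "('p form set, 'p) kripke" where
  "canonical = (let W = {w. theory_closed w \<and> disj_prime w \<and> \<bottom>\<^sub>I \<notin> w} in
     \<lparr>worlds = W, acc = {(w, w'). w \<in> W \<and> w' \<in> W \<and> w \<subseteq> w'}, val = \<lambda>w p. Atom p \<in> w\<rparr>)"

lemma worlds_canonical:
  "w \<in> worlds canonical \<longleftrightarrow> theory_closed w \<and> disj_prime w \<and> \<bottom>\<^sub>I \<notin> w"
  by (simp add: canonical_def Let_def)

lemma acc_canonical:
  "(w, w') \<in> acc canonical \<longleftrightarrow> w \<in> worlds canonical \<and> w' \<in> worlds canonical \<and> w \<subseteq> w'"
  by (simp add: canonical_def Let_def)

lemma val_canonical: "val canonical w p \<longleftrightarrow> Atom p \<in> w"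
  by (simp add: canonical_def Let_def)

lemma kripke_model_canonical: "kripke_model canonical"
proof -
  have "trans (acc canonical)" by (rule transI) (simp add: acc_canonical, blast)
  then show ?thesis
    unfolding kripke_model_def partial_order_on_def preorder_on_def refl_on_def
    by (auto simp: acc_canonical val_canonical intro!: antisymI)
qed

text \<open>Standardness of \<alpha> buys primeness for \<or> in the Lindenbaum lemma; consistency
  follows because an inconsistent theory would contain \<alpha>.\<close>

lemma canonical_separation:
  assumes "standard \<alpha>" "\<not> \<Gamma> \<turnstile>\<^sub>N \<alpha>"
  obtains w where "w \<in> worlds canonical" "\<Gamma> \<subseteq> w" "\<alpha> \<notin> w"
proof -
  obtain w where w: "\<Gamma> \<subseteq> w" "\<alpha> \<notin> w" "theory_closed w" "disj_prime w"
    using assms lindenbaum by metis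
  moreover have "\<bottom>\<^sub>I \<notin> w" using w(2,3) by (meson closed_nd_iff nd.botE)
  ultimately show thesis using that by (simp add: worlds_canonical)
qed

text \<open>Primeness of the worlds handles \<or>, and separation handles implication: if \<beta>
  does not follow from a world together with \<alpha>, some world above contains \<alpha> but lacks
  \<beta>.\<close>

lemma truth_lemma:
  "standard \<alpha> \<Longrightarrow> t \<subseteq> worlds canonical \<Longrightarrow> supports canonical t \<alpha> \<longleftrightarrow> (\<forall>w\<in>t. \<alpha> \<in> w)"
proof (induction \<alpha> arbitrary: t)
  case (Atom p)
  then show ?case by (simp add: val_canonical)
next
  case Bot
  then show ?case by (auto simp: worlds_canonical)
next
  case (Conj \<alpha> \<beta>)
  have "\<alpha> \<^bold>\<and> \<beta> \<in> w \<longleftrightarrow> \<alpha> \<in> w \<and> \<beta> \<in> w" if "w \<in> t" for w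
    using that Conj.prems(2) by (intro closed_conj_iff) (auto simp: worlds_canonical)
  then show ?case using Conj by auto
next
  case (Disj \<alpha> \<beta>)
  have disj_iff: "\<alpha> \<^bold>\<or> \<beta> \<in> w \<longleftrightarrow> \<alpha> \<in> w \<or> \<beta> \<in> w" if "w \<in> t" for w
  proof -
    have "theory_closed w" "disj_prime w"
      using that Disj.prems(2) by (auto simp: worlds_canonical)
    then show ?thesis using closed_disjI unfolding disj_prime_def by blast
  qed
  have IH: "supports canonical s \<alpha> \<longleftrightarrow> (\<forall>w\<in>s. \<alpha> \<in> w)"
    "supports canonical s \<beta> \<longleftrightarrow> (\<forall>w\<in>s. \<beta> \<in> w)" if "s \<subseteq> t" for s
    using Disj that by auto
  show ?case
  proof
    assume "supports canonical t (\<alpha> \<^bold>\<or> \<beta>)"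
    then show "\<forall>w\<in>t. \<alpha> \<^bold>\<or> \<beta> \<in> w" using IH disj_iff by auto
  next
    assume "\<forall>w\<in>t. \<alpha> \<^bold>\<or> \<beta> \<in> w"
    then have "t = {w\<in>t. \<alpha> \<in> w} \<union> {w\<in>t. \<beta> \<in> w}" using disj_iff by blast
    moreover have "supports canonical {w\<in>t. \<alpha> \<in> w} \<alpha>" "supports canonical {w\<in>t. \<beta> \<in> w} \<beta>"
      using IH by auto
    ultimately show "supports canonical t (\<alpha> \<^bold>\<or> \<beta>)" unfolding supports.simps by blast
  qed
next
  case (Imp \<alpha> \<beta>)
  have std: "standard \<alpha>" "standard \<beta>" using Imp.prems by auto
  have sub: "acc canonical `` t \<subseteq> worlds canonical" by (auto simp: acc_canonical)
  have IH: "supports canonical s \<alpha> \<longleftrightarrow> (\<forall>w\<in>s. \<alpha> \<in> w)"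
    "supports canonical s \<beta> \<longleftrightarrow> (\<forall>w\<in>s. \<beta> \<in> w)" if "s \<subseteq> acc canonical `` t" for s
    using Imp.IH(1)[OF std(1)] Imp.IH(2)[OF std(2)] order_trans[OF that sub] by simp_all
  show ?case
  proof (intro iffI ballI)
    fix w assume *: "supports canonical t (\<alpha> \<^bold>\<rightarrow> \<beta>)" and w: "w \<in> t"
    have world: "w \<in> worlds canonical" using w Imp.prems(2) by blast
    have "insert \<alpha> w \<turnstile>\<^sub>N \<beta>"
    proof (rule ccontr)
      assume "\<not> insert \<alpha> w \<turnstile>\<^sub>N \<beta>"
      then obtain w' where w': "w' \<in> worlds canonical" "insert \<alpha> w \<subseteq> w'" "\<beta> \<notin> w'"
        using canonical_separation[OF std(2)] by blast
      \<comment> \<open>The singleton of the separating world is a subteam of the image that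
        supports \<alpha> but not \<beta>.\<close>
      then have "{w'} \<subseteq> acc canonical `` t" using w world by (auto simp: acc_canonical)
      then show False using * w' IH[of "{w'}"] by simp
    qed
    then show "\<alpha> \<^bold>\<rightarrow> \<beta> \<in> w" using world by (simp add: worlds_canonical closed_imp_iff)
  next
    assume *: "\<forall>w\<in>t. \<alpha> \<^bold>\<rightarrow> \<beta> \<in> w"
    have "\<beta> \<in> w'" if w': "w' \<in> acc canonical `` t" "\<alpha> \<in> w'" for w'
    proof -
      obtain w where "w \<in> t" "(w, w') \<in> acc canonical" using w'(1) by blast
      then have "\<alpha> \<^bold>\<rightarrow> \<beta> \<in> w'" "theory_closed w'"
        using * by (auto simp: acc_canonical worlds_canonical)
      then show ?thesis using w'(2) by (meson closed_nd_iff nd.impE)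
    qed
    then show "supports canonical t (\<alpha> \<^bold>\<rightarrow> \<beta>)"
      unfolding supports.simps using IH by (meson subsetD)
  qed
qed simp

text \<open>Worlds of the countermodel are sets of formulas, which determines the type at which
  entailment is assumed.\<close>

theorem theorem4p21:
  fixes \<Phi> :: "'p form set" and \<psi> :: "'p form"
  assumes "entails TYPE('p form set) \<Phi> \<psi>"
  shows "\<Phi> \<turnstile>\<^sub>I\<^sub>n\<^sub>q\<^sub>I \<psi>"
proof (rule nd_compact, rule ccontr)
  assume "\<not> \<Phi> \<turnstile>\<^sub>N \<psi>"
  then obtain \<Delta> where \<Delta>: "\<Phi> \<subseteq> \<Delta>" "\<psi> \<notin> \<Delta>" "theory_closed \<Delta>" "idisj_prime \<Delta>"
    by (rule lindenbaum)
  define \<Gamma> where "\<Gamma> = {\<alpha>\<in>\<Delta>. standard \<alpha>}"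
  define t where "t = {w \<in> worlds canonical. \<Gamma> \<subseteq> w}"
  have t: "t \<subseteq> worlds canonical" by (auto simp: t_def)
  \<comment> \<open>By separation, a standard formula contained in all worlds extending \<Gamma> is
    derivable from \<Gamma>; the truth lemma translates this into support.\<close>
  have supports_t: "supports canonical t \<alpha> \<longleftrightarrow> \<Gamma> \<turnstile>\<^sub>N \<alpha>" if "standard \<alpha>" for \<alpha>
  proof -
    have "(\<forall>w\<in>t. \<alpha> \<in> w) \<longleftrightarrow> \<Gamma> \<turnstile>\<^sub>N \<alpha>"
    proof
      assume "\<forall>w\<in>t. \<alpha> \<in> w"
      then show "\<Gamma> \<turnstile>\<^sub>N \<alpha>" using canonical_separation[OF that] unfolding t_def by blast
    next
      assume "\<Gamma> \<turnstile>\<^sub>N \<alpha>"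
      then show "\<forall>w\<in>t. \<alpha> \<in> w"
        unfolding t_def worlds_canonical using closedD nd_mono by blast
    qed
    then show ?thesis using truth_lemma[OF that t] by simp
  qed
  have "supports canonical t \<phi>" if "\<phi> \<in> \<Phi>" for \<phi>
  proof -
    have "\<phi> \<in> \<Delta>" using that \<Delta>(1) by blast
    then obtain \<alpha> where \<alpha>: "\<alpha> \<in> set (resolutions \<phi>)" "\<alpha> \<in> \<Delta>"
      using closed_resolutions_iff[OF \<Delta>(3,4)] by blast
    then have "standard \<alpha>" "\<Gamma> \<turnstile>\<^sub>N \<alpha>"
      using resolutions_standard by (auto simp: \<Gamma>_def intro: nd.assm)
    then show ?thesis using supports_t \<alpha>(1) supports_resolutions_iff by blast
  qed
  then have "supports canonical t \<psi>"
    using assms kripke_model_canonical t unfolding entails_def team_def by blast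
  \<comment> \<open>Passing to a resolution makes the supported formula standard, so support can be
    turned back into derivability from \<Gamma>.\<close>
  then obtain \<beta> where \<beta>: "\<beta> \<in> set (resolutions \<psi>)" "supports canonical t \<beta>"
    using supports_resolutions_iff by blast
  then have "\<Gamma> \<turnstile>\<^sub>N \<beta>" using supports_t resolutions_standard by blast
  then have "\<Delta> \<turnstile>\<^sub>N \<beta>" by (rule nd_mono) (auto simp: \<Gamma>_def)
  then have "\<psi> \<in> \<Delta>"
    using \<beta>(1) \<Delta>(3) closed_entailed closedD resolution_nd by blast
  then show False using \<Delta>(2) by contradiction
qed

end
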